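(* For every integer $k\geq 2$ there exists a finite magical graph $G$ such that $\omega(G)=k$ and $\chi(G)=\binom{k+1}{2}$.
   Context: A double-ordered graph $G_{<_1,<_2}$ is a graph with two total orders $<_1,<_2$ on its vertex set; it is magical if for any three distinct vertices $a<_1 b<_1 c$ with $ab,bc\in E(G)$ and $ac\notin E(G)$ we have $b<_2 a$ and $b<_2 c$. A graph $G$ is magical if there exist total orders $<_1,<_2$ on $V(G)$ such that $G_{<_1,<_2}$ is magical. $\omega$ and $\chi$ denote clique number and chromatic number. *)

theory Defs
  imports "HOL-Library.Ramsey"
begin

text \<open>Simple graphs are given by a vertex set \<open>V\<close> and a set \<open>E\<close> of two-element subsets of \<open>V\<close>,
  in the style of \<^const>\<open>clique\<close> from the library.\<close>

definition simple_graph :: "'a set \<Rightarrow> 'a set set \<Rightarrow> bool" where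
  "simple_graph V E \<longleftrightarrow> E \<subseteq> [V]\<^bsup>2\<^esup>"

text \<open>The conventions for \<open>Max\<close> and \<open>LEAST\<close> make the next two numbers meaningful for finite graphs
  only, cf. the lemmas at the end.\<close>

definition clique_number :: "'a set \<Rightarrow> 'a set set \<Rightarrow> nat" where
  "clique_number V E = Max {card K | K. K \<subseteq> V \<and> clique K E}"

definition proper_colouring :: "'a set \<Rightarrow> 'a set set \<Rightarrow> nat \<Rightarrow> ('a \<Rightarrow> nat) \<Rightarrow> bool" where
  "proper_colouring V E n c \<longleftrightarrow>
     c ` V \<subseteq> {..<n} \<and> (\<forall>u\<in>V. \<forall>v\<in>V. {u, v} \<in> E \<longrightarrow> c u \<noteq> c v)"

definition chromatic_number :: "'a set \<Rightarrow> 'a set set \<Rightarrow> nat" where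
  "chromatic_number V E = (LEAST n. \<exists>c. proper_colouring V E n c)"

text \<open>The two orders are strict; the inclusions are needed because \<^const>\<open>strict_linear_order_on\<close>
  does not confine the relation to its carrier.\<close>

definition double_ordered_graph ::
    "'a set \<Rightarrow> 'a set set \<Rightarrow> 'a rel \<Rightarrow> 'a rel \<Rightarrow> bool" where
  "double_ordered_graph V E lt1 lt2 \<longleftrightarrow>
     simple_graph V E \<and>
     lt1 \<subseteq> V \<times> V \<and> strict_linear_order_on V lt1 \<and>
     lt2 \<subseteq> V \<times> V \<and> strict_linear_order_on V lt2"

definition magical_double_ordered_graph ::
    "'a set \<Rightarrow> 'a set set \<Rightarrow> 'a rel \<Rightarrow> 'a rel \<Rightarrow> bool" where
  "magical_double_ordered_graph V E lt1 lt2 \<longleftrightarrow>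
     double_ordered_graph V E lt1 lt2 \<and>
     (\<forall>a\<in>V. \<forall>b\<in>V. \<forall>c\<in>V.
        (a, b) \<in> lt1 \<and> (b, c) \<in> lt1 \<and> {a, b} \<in> E \<and> {b, c} \<in> E \<and> {a, c} \<notin> E
        \<longrightarrow> (b, a) \<in> lt2 \<and> (b, c) \<in> lt2)"

definition magical_graph :: "'a set \<Rightarrow> 'a set set \<Rightarrow> bool" where
  "magical_graph V E \<longleftrightarrow> (\<exists>lt1 lt2. magical_double_ordered_graph V E lt1 lt2)"

lemma clique_number_attained:
  fixes V :: "'a set"
  assumes "finite V"
  shows "\<exists>K\<subseteq>V. clique K E \<and> card K = clique_number V E"
    and "K \<subseteq> V \<Longrightarrow> clique K E \<Longrightarrow> card K \<le> clique_number V E"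
proof -
  let ?S = "{card K | K. K \<subseteq> V \<and> clique K E}"
  have fin: "finite ?S"
    using assms by simp
  have "card ({} :: 'a set) \<in> ?S"
    by (intro CollectI exI[of _ "{}"]) auto
  then have "Max ?S \<in> ?S"
    using fin by (intro Max_in) auto
  then show "\<exists>K\<subseteq>V. clique K E \<and> card K = clique_number V E"
    unfolding clique_number_def by auto
  show "card K \<le> clique_number V E" if "K \<subseteq> V" "clique K E"
    unfolding clique_number_def using fin that by (intro Max_ge) auto
qed

lemma chromatic_number_attained:
  assumes "finite V" "simple_graph V E"
  shows "\<exists>c. proper_colouring V E (chromatic_number V E) c"
    and "proper_colouring V E n c \<Longrightarrow> chromatic_number V E \<le> n"
proof -
  obtain h where h: "bij_betw h V {0..<card V}"
    using ex_bij_betw_finite_nat[OF assms(1)] by blast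
  have "h u \<noteq> h v" if "u \<in> V" "v \<in> V" "{u, v} \<in> E" for u v
    using that h assms(2) unfolding simple_graph_def bij_betw_def inj_on_def
    by (metis doubleton_in_nsets_2 subsetD)
  then have "proper_colouring V E (card V) h"
    using h unfolding proper_colouring_def bij_betw_def by auto
  then have "\<exists>n c. proper_colouring V E n c"
    by blast
  then show "\<exists>c. proper_colouring V E (chromatic_number V E) c"
    unfolding chromatic_number_def by (rule LeastI_ex)
  show "proper_colouring V E n c \<Longrightarrow> chromatic_number V E \<le> n"
    unfolding chromatic_number_def by (auto intro: Least_le)
qed

end

theory Submission
  imports Defs "HOL-Library.Countable" "HOL-Library.Product_Lexorder"
begin

text \<open>A Zykov-type construction in \<open>k\<close> stages. To pass from \<open>H\<close> to the next stage, take as many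
  disjoint copies of \<open>H\<close> as \<open>H\<close> needs colours, and for every choice \<open>f\<close> of one vertex from each copy
  add a new clique (a chain), all of whose vertices are joined to the chosen vertices and to the
  older neighbours of these; the chains get one vertex shorter in every stage, starting with \<open>k\<close>.
  In any colouring one can choose the vertices \<open>f\<close> greedily with pairwise distinct colours, and then
  the chain of \<open>f\<close> needs entirely new colours, so that \<open>k + (k - 1) + \<dots> + 1\<close> colours are necessary.
  In the older neighbourhood of a vertex any two vertices of the same stage are nonadjacent, which
  bounds the cliques. The graph is magical when \<open><\<^sub>1\<close> lists newer vertices first, \<open><\<^sub>2\<close> lists
  older vertices first, and both orders agree within each stage.\<close>

datatype vert = Copy nat vert | Join "vert list" nat

instance vert :: countable
  by countable_datatype

text \<open>The depth of a vertex counts the stages that follow its creation.\<close>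

primrec depth :: "vert \<Rightarrow> nat" where
  "depth (Copy i v) = Suc (depth v)"
| "depth (Join f p) = 0"

primrec pos :: "vert \<Rightarrow> nat" where
  "pos (Copy i v) = pos v"
| "pos (Join f p) = p"

text \<open>The vertex at position 0 names the whole chain, so that lying in a common chain becomes
  an equation.\<close>

primrec chain :: "vert \<Rightarrow> vert" where
  "chain (Copy i v) = Copy i (chain v)"
| "chain (Join f p) = Join f 0"

text \<open>The second clause does not mention \<open>p\<close>, so a chain shares its older
  neighbours; of the chain of \<open>f ! i\<close> it takes \<open>f ! i\<close> alone.\<close>

fun older_nbr :: "vert \<Rightarrow> vert \<Rightarrow> bool" where
  "older_nbr (Copy i u) (Copy j v) \<longleftrightarrow> i = j \<and> older_nbr u v"
| "older_nbr (Join f p) (Copy i v) \<longleftrightarrow> i < length f \<and> (v = f ! i \<or> older_nbr (f ! i) v)"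
| "older_nbr u (Join f p) \<longleftrightarrow> False"

definition adj :: "vert \<Rightarrow> vert \<Rightarrow> bool" where
  "adj u v \<longleftrightarrow> u \<noteq> v \<and> (chain u = chain v \<or> older_nbr u v \<or> older_nbr v u)"

text \<open>A closed formula for the number of colours that stage \<open>j\<close> forces, so that
  \<open>verts\<close> can be defined without colourings.\<close>

definition ncol :: "nat \<Rightarrow> nat \<Rightarrow> nat" where
  "ncol k j = (\<Sum>i<j. k - i)"

primrec verts :: "nat \<Rightarrow> nat \<Rightarrow> vert set" where
  "verts k 0 = {}"
| "verts k (Suc j) = (\<Union>i<ncol k j. Copy i ` verts k j) \<union>
     (\<Union>f\<in>{f. set f \<subseteq> verts k j \<and> length f = ncol k j}. Join f ` {..<k - j})"

section \<open>Chains and older neighbours\<close>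

lemma chain_depth: "chain u = chain v \<Longrightarrow> depth u = depth v"
proof (induction u arbitrary: v)
  case (Copy i u)
  obtain v' where "v = Copy i v'" "chain u = chain v'"
    using Copy.prems by (cases v) auto
  with Copy.IH[of v'] show ?case by simp
next
  case (Join f p)
  then show ?case by (cases v) auto
qed

lemma vert_eqI: "chain u = chain v \<Longrightarrow> pos u = pos v \<Longrightarrow> u = v"
proof (induction u arbitrary: v)
  case (Copy i u)
  then show ?case by (cases v) auto
next
  case (Join f p)
  then show ?case by (cases v) auto
qed

lemma older_nbr_depth: "older_nbr u v \<Longrightarrow> depth u < depth v"
  by (induction u v rule: older_nbr.induct) auto

text \<open>A new vertex inherits the older neighbours of each chosen vertex; magicality will rest
  on this.\<close>

lemma older_nbr_trans: "older_nbr u v \<Longrightarrow> older_nbr v w \<Longrightarrow> older_nbr u w"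
proof (induction u v arbitrary: w rule: older_nbr.induct)
  case (1 i u j v)
  then show ?case by (cases w) auto
next
  case (2 f p i v)
  then show ?case by (cases w) auto
qed simp

lemma older_nbr_chain: "older_nbr u v \<Longrightarrow> chain u = chain u' \<Longrightarrow> older_nbr u' v"
proof (induction u v arbitrary: u' rule: older_nbr.induct)
  case (1 i u j v)
  then show ?case by (cases u') auto
next
  case (2 f p i v)
  then show ?case by (cases u') auto
qed simp

text \<open>Within copy \<open>i\<close> a new vertex sees only \<open>f ! i\<close> and what is
  older than it, so the claim descends to \<open>f ! i\<close>.\<close>

lemma older_nbr_inj: "older_nbr u v \<Longrightarrow> older_nbr u w \<Longrightarrow> chain v = chain w \<Longrightarrow> v = w"
proof (induction u v arbitrary: w rule: older_nbr.induct)
  case (1 i u j v)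
  then show ?case by (cases w) auto
next
  case (2 f p i v)
  obtain w' where w: "w = Copy i w'" "chain v = chain w'"
    using 2 by (cases w) auto
  \<comment> \<open>Equal depths exclude the mixed case where one vertex is \<open>f ! i\<close> and
    the other is strictly older.\<close>
  then have "depth v = depth w'"
    by (intro chain_depth)
  moreover have "v = f ! i \<or> older_nbr (f ! i) v" "w' = f ! i \<or> older_nbr (f ! i) w'" "i < length f"
    using 2(2,3) w(1) by auto
  moreover have "v = w'" if "older_nbr (f ! i) v" "older_nbr (f ! i) w'"
    using 2(1) calculation that w(2) by blast
  ultimately have "v = w'"
    using older_nbr_depth by fastforce
  then show ?case
    using w(1) by simp
qed simp

lemma finite_verts: "finite (verts k j)"
  by (induction j) (auto simp: finite_lists_length_eq)

lemma depth_verts: "v \<in> verts k j \<Longrightarrow> depth v < j"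
  by (induction j arbitrary: v) auto

text \<open>A vertex of depth \<open>d\<close> was created in passing from stage
  \<open>j - d - 1\<close> to the next one, in a chain of length \<open>k - (j - d - 1)\<close>. For
  \<open>j = k\<close> this yields \<open>pos v \<le> depth v\<close>.\<close>

lemma pos_verts: "v \<in> verts k j \<Longrightarrow> pos v + j \<le> k + depth v"
proof (induction j arbitrary: v)
  case (Suc j)
  then show ?case by fastforce
qed simp

lemma ncol_triangle: "ncol k k = triangle k"
proof -
  have "ncol k j + triangle (k - j) = triangle k" if "j \<le> k" for j
    using that
  proof (induction j)
    case (Suc j)
    then have "k - j = Suc (k - Suc j)"
      by simp
    then have "triangle (k - j) = triangle (k - Suc j) + (k - j)"
      by (metis triangle_Suc)
    with Suc show ?case
      by (simp add: ncol_def)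
  qed (simp add: ncol_def)
  from this[of k] show ?thesis by simp
qed

section \<open>Forcing many colours\<close>

text \<open>Greedy choice: the \<open>i\<close> earlier values cannot exhaust
  \<open>A i\<close>.\<close>

lemma distinct_representatives:
  assumes "\<And>i. i < n \<Longrightarrow> i < card (A i)"
  shows "\<exists>g. (\<forall>i<n. g i \<in> A i) \<and> inj_on g {..<n}"
  using assms
proof (induction n)
  case (Suc n)
  then obtain g where g: "\<forall>i<n. g i \<in> A i" "inj_on g {..<n}"
    by auto
  have "card (g ` {..<n}) < card (A n)"
    using g(2) Suc.prems[of n] by (simp add: card_image)
  then have "\<not> A n \<subseteq> g ` {..<n}"
    by (meson card_mono finite_imageI finite_lessThan not_le)
  then obtain a where "a \<in> A n" "a \<notin> g ` {..<n}"
    by blast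
  with g have "(\<forall>i<Suc n. (g(n := a)) i \<in> A i) \<and> inj_on (g(n := a)) {..<Suc n}"
    by (auto simp: inj_on_def less_Suc_eq)
  then show ?case by blast
qed simp

lemma colours_verts:
  assumes "\<And>u v. u \<in> verts k j \<Longrightarrow> v \<in> verts k j \<Longrightarrow> adj u v \<Longrightarrow> c u \<noteq> c v"
  shows "ncol k j \<le> card (c ` verts k j)"
  using assms
proof (induction j arbitrary: c)
  case 0
  then show ?case by (simp add: ncol_def)
next
  case (Suc j)
  let ?N = "ncol k j"
  \<comment> \<open>The colouring restricted to copy \<open>i\<close> shows at least
    \<open>?N > i\<close> colours, as the greedy choice requires.\<close>
  have "?N \<le> card ((\<lambda>v. c (Copy i v)) ` verts k j)" if "i < ?N" for i
    using that by (intro Suc.IH Suc.prems) (auto simp: adj_def)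
  then obtain a where a: "\<forall>i<?N. a i \<in> (\<lambda>v. c (Copy i v)) ` verts k j" "inj_on a {..<?N}"
    using distinct_representatives[of ?N "\<lambda>i. (\<lambda>v. c (Copy i v)) ` verts k j"] by fastforce
  then have "\<forall>i<?N. \<exists>v\<in>verts k j. a i = c (Copy i v)"
    by blast
  then obtain g where g: "\<forall>i<?N. g i \<in> verts k j \<and> a i = c (Copy i (g i))"
    by metis
  define f where "f = map g [0..<?N]"
  have f: "set f \<subseteq> verts k j" "length f = ?N"
    using g by (auto simp: f_def)
  have new: "Join f p \<in> verts k (Suc j)" if "p < k - j" for p
    using f that by auto
  have old: "Copy i (g i) \<in> verts k (Suc j)" if "i < ?N" for i
    using g that by auto
  let ?b = "\<lambda>p. c (Join f p)"
  have "inj_on ?b {..<k - j}"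
  proof (rule inj_onI)
    fix p q assume *: "p \<in> {..<k - j}" "q \<in> {..<k - j}" "?b p = ?b q"
    then show "p = q"
      using Suc.prems[OF new new, of p q] by (auto simp: adj_def)
  qed
  \<comment> \<open>Each chain vertex of \<open>f\<close> is joined to every representative, so the
    chain avoids all \<open>?N\<close> colours chosen.\<close>
  moreover have "?b p \<noteq> a i" if "p < k - j" "i < ?N" for p i
  proof -
    have "adj (Join f p) (Copy i (g i))"
      using that(2) by (simp add: adj_def f_def)
    then show ?thesis
      using Suc.prems[OF new old] that g by metis
  qed
  then have "a ` {..<?N} \<inter> ?b ` {..<k - j} = {}"
    by force
  ultimately have "card (a ` {..<?N} \<union> ?b ` {..<k - j}) = ncol k (Suc j)"
    using a(2) by (simp add: card_Un_disjoint card_image ncol_def)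
  moreover have "a ` {..<?N} \<union> ?b ` {..<k - j} \<subseteq> c ` verts k (Suc j)"
    using g old new by (intro Un_least image_subsetI) (simp_all del: verts.simps)
  ultimately show ?case
    by (metis card_mono finite_imageI finite_verts)
qed

section \<open>Clique sizes\<close>

text \<open>The chain of full length \<open>k\<close> arises in the first stage and survives in copy
  0 of every later one.\<close>

lemma verts_clique:
  assumes "k > 0"
  shows "\<exists>K\<subseteq>verts k (Suc j). card K = k \<and> (\<forall>u\<in>K. \<forall>v\<in>K. chain u = chain v)"
proof (induction j)
  case 0
  \<comment> \<open>Since \<open>ncol k 0 = 0\<close>, the empty list is the only choice in the
    first stage.\<close>
  have "card (Join [] ` {..<k}) = k"
    by (simp add: card_image inj_on_def)
  then show ?case
    by (intro exI[of _ "Join [] ` {..<k}"]) (auto simp: ncol_def)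
next
  case (Suc j)
  then obtain K where K: "K \<subseteq> verts k (Suc j)" "card K = k" "\<forall>u\<in>K. \<forall>v\<in>K. chain u = chain v"
    by blast
  have "0 < ncol k (Suc j)"
    using assms by (auto simp: ncol_def sum.lessThan_Suc_shift simp del: sum.lessThan_Suc)
  then have "Copy 0 ` K \<subseteq> verts k (Suc (Suc j))"
    using K(1) by (auto simp del: verts.simps simp: verts.simps(2)[of k "Suc j"])
  moreover have "card (Copy 0 ` K) = k"
    using K(2) by (simp add: card_image inj_on_def)
  moreover have "\<forall>u\<in>Copy 0 ` K. \<forall>v\<in>Copy 0 ` K. chain u = chain v"
    using K(3) by (metis chain.simps(1) imageE)
  ultimately show ?case by blast
qed

text \<open>Let \<open>u\<close> be a newest vertex of the clique. Its chain is counted by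
  positions, which are at most \<open>depth u\<close>; all other vertices are older neighbours of
  \<open>u\<close>, counted by their larger depths. No value in \<open>{..<k}\<close> occurs
  twice.\<close>

lemma card_clique_le:
  assumes K: "K \<subseteq> verts k k" and adj: "\<And>u v. u \<in> K \<Longrightarrow> v \<in> K \<Longrightarrow> u \<noteq> v \<Longrightarrow> adj u v"
  shows "card K \<le> k"
proof (cases "K = {}")
  case False
  then obtain u where u: "u \<in> K" "\<And>v. v \<in> K \<Longrightarrow> depth u \<le> depth v"
    using ex_has_least_nat[of "\<lambda>v. v \<in> K" _ depth] by blast
  define h where "h v = (if chain v = chain u then pos v else depth v)" for v
  have older: "older_nbr u v" if "v \<in> K" "chain v \<noteq> chain u" for v
    using adj[OF u(1) that(1)] u(2)[OF that(1)] that(2) older_nbr_depth[of v u]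
    by (auto simp: adj_def)
  have bound: "pos v \<le> depth v" "depth v < k" if "v \<in> K" for v
    using that K pos_verts[of v k k] depth_verts[of v k k] by auto
  have small: "pos v < depth w"
    if "v \<in> K" "chain v = chain u" "w \<in> K" "chain w \<noteq> chain u" for v w
    using bound[OF that(1)] chain_depth[OF that(2)] older_nbr_depth[OF older[OF that(3,4)]] by simp
  have "inj_on h K"
  proof (rule inj_onI)
    fix v w assume vw: "v \<in> K" "w \<in> K" "h v = h w"
    consider "chain v = chain u" "chain w = chain u" | "chain v \<noteq> chain u" "chain w \<noteq> chain u"
      using vw small[of v w] small[of w v] by (fastforce simp: h_def split: if_splits)
    then show "v = w"
    proof cases
      case 1
      then show ?thesis using vw(3) by (auto simp: h_def intro: vert_eqI)
    next
      case 2
      then have d: "depth v = depth w"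
        using vw(3) by (simp add: h_def)
      show ?thesis
      proof (rule ccontr)
        assume "v \<noteq> w"
        then have "chain v = chain w"
          using adj[OF vw(1,2)] d by (auto simp: adj_def dest: older_nbr_depth)
        then show False
          \<comment> \<open>Both vertices are older neighbours of \<open>u\<close> in one chain,
            hence equal.\<close>
          using older_nbr_inj older 2 vw \<open>v \<noteq> w\<close> by blast
      qed
    qed
  qed
  moreover have "h ` K \<subseteq> {..<k}"
    using bound by (fastforce simp: h_def)
  ultimately show ?thesis
    using card_inj_on_le[of h K "{..<k}"] by simp
qed simp

section \<open>The two orders and the final graph\<close>

lemma strict_linear_order_on_key:
  fixes key :: "'a \<Rightarrow> 'b::linorder"
  assumes "inj_on key V"
  shows "strict_linear_order_on V {(x, y). x \<in> V \<and> y \<in> V \<and> key x < key y}"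
proof -
  have "key x < key y \<or> key y < key x" if "x \<in> V" "y \<in> V" "x \<noteq> y" for x y
    using that assms by (meson inj_onD neqE)
  then show ?thesis
    unfolding strict_linear_order_on_def by (auto simp: trans_def irrefl_def total_on_def)
qed

theorem theorem7:
  fixes k :: nat
  assumes "k \<ge> 2"
  shows "\<exists>(V :: nat set) (E :: nat set set).
           finite V \<and> magical_graph V E \<and>
           clique_number V E = k \<and> chromatic_number V E = (k + 1) choose 2"
proof -
  define g :: "nat \<Rightarrow> vert" where "g = from_nat"
  define V where "V = to_nat ` verts k k"
  define E where "E = {{x, y} | x y. x \<in> V \<and> y \<in> V \<and> adj (g x) (g y)}"
  have g_to_nat: "g (to_nat v) = v" for v
    by (simp add: g_def)
  have gV: "g x \<in> verts k k" if "x \<in> V" for x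
    using that by (auto simp: V_def g_to_nat)
  have g_inj: "x = y" if "x \<in> V" "y \<in> V" "g x = g y" for x y
    using that by (auto simp: V_def g_to_nat)
  have fin: "finite V"
    by (simp add: V_def finite_verts)
  have adj_sym: "adj u v \<Longrightarrow> adj v u" for u v
    by (auto simp: adj_def)
  have E: "{x, y} \<in> E \<longleftrightarrow> adj (g x) (g y)" if "x \<in> V" "y \<in> V" for x y
    using that adj_sym by (auto simp: E_def doubleton_eq_iff)
  have simple: "simple_graph V E"
    by (auto simp: simple_graph_def E_def adj_def doubleton_in_nsets_2)

  \<comment> \<open>Chain codes precede positions, so chains are intervals and the keys are
    injective; only the sign of the depth differs between the keys.\<close>
  define key1 where "key1 x = (depth (g x), to_nat (chain (g x)), pos (g x))" for x
  define key2 where "key2 x = (- int (depth (g x)), to_nat (chain (g x)), pos (g x))" for x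
  have key1: "inj_on key1 V" and key2: "inj_on key2 V"
    by (auto simp: inj_on_def key1_def key2_def intro: g_inj vert_eqI)
  let ?lt1 = "{(x, y). x \<in> V \<and> y \<in> V \<and> key1 x < key1 y}"
  let ?lt2 = "{(x, y). x \<in> V \<and> y \<in> V \<and> key2 x < key2 y}"
  have "double_ordered_graph V E ?lt1 ?lt2"
    unfolding double_ordered_graph_def
    using simple strict_linear_order_on_key[OF key1] strict_linear_order_on_key[OF key2] by auto
  moreover have "key2 b < key2 a \<and> key2 b < key2 c"
    if V: "a \<in> V" "b \<in> V" "c \<in> V" and lt: "key1 a < key1 b" "key1 b < key1 c"
      and ab: "adj (g a) (g b)" and bc: "adj (g b) (g c)" and ac: "\<not> adj (g a) (g c)" for a b c
  proof -
    have le: "depth (g a) \<le> depth (g b)" "depth (g b) \<le> depth (g c)"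
      using lt by (auto simp: key1_def less_prod_def)
    have "key1 a \<noteq> key1 c"
      using lt by order
    then have "g a \<noteq> g c"
      by (auto simp: key1_def)
    have ab': "chain (g a) = chain (g b) \<or> older_nbr (g a) (g b)"
      using ab le by (auto simp: adj_def dest: older_nbr_depth)
    have bc': "chain (g b) = chain (g c) \<or> older_nbr (g b) (g c)"
      using bc le by (auto simp: adj_def dest: older_nbr_depth)
    \<comment> \<open>Otherwise \<open>a\<close> would share the older neighbours of
      \<open>b\<close>, and \<open>c\<close> would be adjacent to \<open>a\<close>.\<close>
    have "chain (g a) \<noteq> chain (g b)"
      using ac bc' \<open>g a \<noteq> g c\<close> older_nbr_chain[of "g b" "g c" "g a"] by (auto simp: adj_def)
    then have older: "older_nbr (g a) (g b)"
      using ab' by blast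
    \<comment> \<open>If \<open>c\<close> were an older neighbour of \<open>b\<close>, transitivity
      would make it one of \<open>a\<close>.\<close>
    then have same: "chain (g b) = chain (g c)"
      using ac bc' \<open>g a \<noteq> g c\<close> older_nbr_trans[of "g a" "g b" "g c"] by (auto simp: adj_def)
    have "key2 b < key2 a"
      using older_nbr_depth[OF older] by (simp add: key2_def)
    moreover have "key2 b < key2 c"
      using lt(2) same chain_depth[OF same] by (simp add: key1_def key2_def)
    ultimately show ?thesis by blast
  qed
  ultimately have "magical_double_ordered_graph V E ?lt1 ?lt2"
    by (auto simp: magical_double_ordered_graph_def E)
  then have magical: "magical_graph V E"
    unfolding magical_graph_def by blast

  have "clique_number V E \<le> k"
  proof -
    obtain K where K: "K \<subseteq> V" "clique K E" "card K = clique_number V E"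
      using clique_number_attained(1)[OF fin] by blast
    have adjK: "adj (g x) (g y)" if "x \<in> K" "y \<in> K" "g x \<noteq> g y" for x y
      using that K(1,2) E by (metis clique_def subsetD)
    have "card (g ` K) \<le> k"
      using K(1) gV adjK by (intro card_clique_le) auto
    moreover have "inj_on g K"
      using K(1) g_inj by (meson inj_onI subsetD)
    ultimately show ?thesis
      using K(3) by (simp add: card_image)
  qed
  moreover have "k \<le> clique_number V E"
  proof -
    obtain K where K: "K \<subseteq> verts k k" "card K = k" "\<forall>u\<in>K. \<forall>v\<in>K. chain u = chain v"
      using verts_clique[of k "k - 1"] assms by auto
    have sub: "to_nat ` K \<subseteq> V"
      using K(1) by (auto simp: V_def)
    have "clique (to_nat ` K) E"
      unfolding clique_def
    proof (intro ballI impI)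
      fix x y assume xy: "x \<in> to_nat ` K" "y \<in> to_nat ` K" "x \<noteq> y"
      then obtain u v where "u \<in> K" "v \<in> K" "u \<noteq> v" "x = to_nat u" "y = to_nat v"
        by blast
      then have "adj (g x) (g y)"
        using K(3) by (metis adj_def g_to_nat)
      then show "{x, y} \<in> E"
        using E sub xy by blast
    qed
    then have "card (to_nat ` K) \<le> clique_number V E"
      using clique_number_attained(2)[OF fin] sub by blast
    then show ?thesis
      using K(2) by (simp add: card_image inj_on_def)
  qed
  ultimately have clique: "clique_number V E = k"
    by (rule antisym)

  have choose: "(k + 1) choose 2 = triangle k"
    by (simp add: choose_two triangle_def mult.commute)
  have "chromatic_number V E \<le> triangle k"
  proof -
    \<comment> \<open>The colour encodes the pair of position and depth as
      \<open>triangle (depth (g x)) + pos (g x)\<close>; adjacent vertices of equal depth share a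
      chain and differ in position.\<close>
    define c where "c x = prod_encode (pos (g x), depth (g x) - pos (g x))" for x
    have bound: "pos (g x) \<le> depth (g x)" "depth (g x) < k" if "x \<in> V" for x
      using pos_verts[OF gV[OF that]] depth_verts[OF gV[OF that]] by auto
    have "c x < triangle k" if "x \<in> V" for x
    proof -
      have "c x = triangle (depth (g x)) + pos (g x)"
        using bound[OF that] by (simp add: c_def prod_encode_def)
      also have "\<dots> < triangle (Suc (depth (g x)))"
        using bound[OF that] by simp
      also have "\<dots> \<le> triangle k"
        unfolding triangle_def using bound(2)[OF that]
        by (intro div_le_mono mult_le_mono) auto
      finally show ?thesis .
    qed
    moreover have "c x \<noteq> c y" if "x \<in> V" "y \<in> V" "adj (g x) (g y)" for x y
    proof
      assume "c x = c y"
      then have "pos (g x) = pos (g y)" "depth (g x) = depth (g y)"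
        using bound[OF that(1)] bound[OF that(2)] by (auto simp: c_def)
      then show False
        using that(3) vert_eqI by (auto simp: adj_def dest: older_nbr_depth)
    qed
    ultimately have "proper_colouring V E (triangle k) c"
      by (auto simp: proper_colouring_def E)
    then show ?thesis
      using chromatic_number_attained(2)[OF fin simple] by blast
  qed
  moreover have "triangle k \<le> chromatic_number V E"
  proof -
    obtain c where c: "proper_colouring V E (chromatic_number V E) c"
      using chromatic_number_attained(1)[OF fin simple] by blast
    have to_V: "to_nat u \<in> V" if "u \<in> verts k k" for u
      using that by (simp add: V_def)
    have "ncol k k \<le> card ((\<lambda>v. c (to_nat v)) ` verts k k)"
    proof (rule colours_verts)
      fix u v assume "u \<in> verts k k" "v \<in> verts k k" "adj u v"
      then show "c (to_nat u) \<noteq> c (to_nat v)"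
        using c to_V E[of "to_nat u" "to_nat v"] unfolding proper_colouring_def g_to_nat by blast
    qed
    also have "\<dots> \<le> card {..<chromatic_number V E}"
      using c to_V by (intro card_mono) (auto simp: proper_colouring_def)
    finally show ?thesis
      by (simp add: ncol_triangle)
  qed
  ultimately have "chromatic_number V E = (k + 1) choose 2"
    using choose by linarith
  with fin magical clique show ?thesis by blast
qed

end
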